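(* Fix $c>0$ and one of the six models. For every $N$ and every $1\le N_1,N_2\le N-1$ with $N_1+N_2=N$, $$\mathbb{E}\big[H(\mathbb{G}(N,\lfloor cN\rfloor))\big]\ge\mathbb{E}\big[H(\mathbb{G}(N_1,\mathcal{M}_1))\big]+\mathbb{E}\big[H(\mathbb{G}(N_2,\mathcal{M}_2))\big],$$ where $\mathcal{M}_1\sim\mathrm{Bi}(\lfloor cN\rfloor,N_1/N)$ and $\mathcal{M}_2=\lfloor cN\rfloor-\mathcal{M}_1\sim\mathrm{Bi}(\lfloor cN\rfloor,N_2/N)$. Additionally, for the Coloring, K-SAT and NAE-K-SAT models, $$p(N,\lfloor cN\rfloor)\ge\mathbb{P}\Big(H\big(\mathbb{G}(N_1,\mathcal{M}_1)\oplus\mathbb{G}(N_2,\mathcal{M}_2)\big)=\mathcal{M}_1+\mathcal{M}_2\Big),$$ where $\oplus$ denotes disjoint union, $\mathbb{G}(N_1,\mathcal{M}_1)$ lives on nodes $\{1,\dots,N_1\}$ and $\mathbb{G}(N_2,\mathcal{M}_2)$ on nodes $\{N_1+1,\dots,N\}$, and given $\mathcal{M}_1$ the two graphs (with their potentials) are generated independently.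
   Context: Let $K\ge2$, $\chi=\{0,\dots,q-1\}$. $\mathbb{G}(n,m)$ on an $n$-element node set $V$: $m$ directed hyperedges chosen independently and uniformly at random from $V^K$. For a hypergraph $G=(V,E)$ with node potentials $H_i$ and edge potentials $H_e:\chi^K\to\mathbb{R}\cup\{-\infty\}$, $H(x)=\sum_{i}H_i(x_i)+\sum_{e\in E}H_e(x_e)$ for $x\in\chi^V$, and $H(G)=\max_xH(x)$. Models: Independent set ($K=2,q=2$, $H_i(1)=1,H_i(0)=0$, $H_e(1,1)=-\infty$, else $0$); MAX-CUT ($K=2,q=2$, $H_i\equiv0$, $H_e(x,y)=\mathbf 1[x\ne y]$); anti-ferromagnetic Ising ($K=2,q=2$, fixed $\beta>0,B\in\mathbb{R}$, $H_i(0)=-B,H_i(1)=B$, $H_e(x,y)=-\beta$ if $x=y$, $\beta$ otherwise); $q$-Coloring ($K=2$, $H_i\equiv0$, $H_e(x,y)=\mathbf 1[x\ne y]$); K-SAT ($q=2$, $H_i\equiv0$, independent uniform $a_e\in\{0,1\}^K$ per hyperedge, $H_e(a_e)=0$, $1$ otherwise); NAE-K-SAT ($H_e(a_e)=H_e(\mathbf1-a_e)=0$, $1$ otherwise). $p(N,M)=\mathbb{P}(H(\mathbb{G}(N,M))=M)$. $\mathrm{Bi}(n,\theta)$ is the binomial distribution. *)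

theory Defs
  imports "HOL-Probability.Probability"
begin

datatype model = IndSet | MaxCut | Ising real real | Coloring nat | KSAT nat | NAEKSAT nat

fun valid_model :: "model \<Rightarrow> bool" where
  "valid_model (Ising \<beta> B) = (\<beta> > 0)"
| "valid_model (Coloring q) = (q \<ge> 2)"
| "valid_model (KSAT K) = (K \<ge> 2)"
| "valid_model (NAEKSAT K) = (K \<ge> 2)"
| "valid_model _ = True"

fun arity :: "model \<Rightarrow> nat" where
  "arity (KSAT K) = K"
| "arity (NAEKSAT K) = K"
| "arity _ = 2"

fun nstates :: "model \<Rightarrow> nat" where
  "nstates (Coloring q) = q"
| "nstates _ = 2"

fun hnode :: "model \<Rightarrow> nat \<Rightarrow> ereal" where
  "hnode IndSet v = (if v = 1 then 1 else 0)"
| "hnode (Ising \<beta> B) v = (if v = 0 then ereal (- B) else ereal B)"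
| "hnode _ v = 0"

text \<open>Edge potential H_e, applied to the (random) sign vector a_e (a bool list,
True = 1, only used for K-SAT / NAE-K-SAT) and the spins x_e of the edge's nodes.\<close>
fun hedge :: "model \<Rightarrow> bool list \<Rightarrow> nat list \<Rightarrow> ereal" where
  "hedge IndSet a xs = (if xs ! 0 = 1 \<and> xs ! 1 = 1 then - \<infinity> else 0)"
| "hedge MaxCut a xs = (if xs ! 0 \<noteq> xs ! 1 then 1 else 0)"
| "hedge (Ising \<beta> B) a xs = (if xs ! 0 = xs ! 1 then ereal (- \<beta>) else ereal \<beta>)"
| "hedge (Coloring q) a xs = (if xs ! 0 \<noteq> xs ! 1 then 1 else 0)"
| "hedge (KSAT K) a xs = (if xs = map of_bool a then 0 else 1)"
| "hedge (NAEKSAT K) a xs =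
     (if xs = map of_bool a \<or> xs = map (\<lambda>b. of_bool (\<not> b)) a then 0 else 1)"

text \<open>A hyperedge is a pair (ordered list of K nodes, sign vector a_e).\<close>
type_synonym edge = "nat list \<times> bool list"

text \<open>Distribution of the sign vector: uniform on {0,1}^K for K-SAT/NAE-K-SAT,
irrelevant (deterministic) otherwise.\<close>
definition sign_pmf :: "model \<Rightarrow> bool list pmf" where
  "sign_pmf m = (case m of
      KSAT K \<Rightarrow> pmf_of_set {a. length a = K}
    | NAEKSAT K \<Rightarrow> pmf_of_set {a. length a = K}
    | _ \<Rightarrow> return_pmf (replicate (arity m) False))"

definition edge_pmf :: "model \<Rightarrow> nat set \<Rightarrow> edge pmf" where
  "edge_pmf m V = pair_pmf (pmf_of_set {xs. set xs \<subseteq> V \<and> length xs = arity m}) (sign_pmf m)"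

fun rgraph :: "model \<Rightarrow> nat set \<Rightarrow> nat \<Rightarrow> edge list pmf" where
  "rgraph m V 0 = return_pmf []"
| "rgraph m V (Suc M) = bind_pmf (edge_pmf m V) (\<lambda>e. map_pmf (\<lambda>es. e # es) (rgraph m V M))"

definition Hx :: "model \<Rightarrow> nat set \<Rightarrow> edge list \<Rightarrow> (nat \<Rightarrow> nat) \<Rightarrow> ereal" where
  "Hx m V E x = (\<Sum>i\<in>V. hnode m (x i)) + (\<Sum>e\<leftarrow>E. hedge m (snd e) (map x (fst e)))"

definition HG :: "model \<Rightarrow> nat set \<Rightarrow> edge list \<Rightarrow> ereal" where
  "HG m V E = Max (Hx m V E ` (PiE V (\<lambda>_. {..<nstates m})))"

text \<open>E[H(G(n,M))] for a random number of edges with law Mdist (H is finite in all six models).\<close>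
definition EH :: "model \<Rightarrow> nat set \<Rightarrow> nat pmf \<Rightarrow> real" where
  "EH m V Mdist = measure_pmf.expectation (bind_pmf Mdist (rgraph m V)) (\<lambda>E. real_of_ereal (HG m V E))"

definition psat :: "model \<Rightarrow> nat \<Rightarrow> nat \<Rightarrow> real" where
  "psat m N M = measure_pmf.prob (rgraph m {..<N} M) {E. HG m {..<N} E = ereal (real M)}"

definition is_csp :: "model \<Rightarrow> bool" where
  "is_csp m = (case m of Coloring _ \<Rightarrow> True | KSAT _ \<Rightarrow> True | NAEKSAT _ \<Rightarrow> True | _ \<Rightarrow> False)"

end

theory Submission
  imports Defs
begin

text \<open>
  Let \<open>V = V1 \<union> V2\<close> be the node set. The maximum over \<open>V\<close> is in fact stochastically
  larger for \<open>n\<close> uniform hyperedges than for \<open>n\<close> independent hyperedges drawn from the mixture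
  that picks \<open>V1\<close> with probability \<open>|V1| / |V|\<close> and \<open>V2\<close> otherwise; both claims are
  statements about these tails. It suffices to exchange one edge at a time. In all six models
  an edge potential takes two values, the lower one when the edge is violated. So, unless it is
  certain, the event that the maximum stays below \<open>t\<close> after adding an edge says that the edge is
  violated by every assignment in some superlevel set \<open>X\<close> of the old energy. This happens
  with probability \<open>\<kappa> * (\<Sum>C. (|C \<inter> W| / |W|) ^ K)\<close> for an edge uniform on \<open>W\<close>: the classes
  \<open>C\<close> consist of the nodes frozen on \<open>X\<close> (independent set, K-SAT), or are the classes of
  nodes whose spins are equal (MAX-CUT, Ising, coloring) or equal up to a fixed relative flip
  (NAE-K-SAT) throughout \<open>X\<close>. Convexity of \<open>x ^ K\<close> then compares \<open>V\<close> with the mixture.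
\<close>

subsection \<open>Stochastic comparison of finite distributions\<close>

text \<open>Hybrid argument: the draws from \<open>q\<close> are exchanged for draws from
  \<open>p\<close> one at a time. Each exchange is an instance of \<open>step\<close> with all other
  entries frozen, and permutation invariance lets the exchanged entry always be the head.\<close>

lemma emeasure_replicate_pmf_mono:
  fixes p q :: "'a pmf" and A :: "'a list set"
  assumes step: "\<And>xs. emeasure q {x. x # xs \<in> A} \<le> emeasure p {x. x # xs \<in> A}"
    and perm: "\<And>xs ys. mset xs = mset ys \<Longrightarrow> xs \<in> A \<longleftrightarrow> ys \<in> A"
  shows "emeasure (replicate_pmf n q) A \<le> emeasure (replicate_pmf n p) A"
proof -
  \<comment> \<open>The suffix \<open>ys\<close> collects the entries already exchanged. It grows
    during the induction, so the claim is proved for every \<open>ys\<close>.\<close>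
  have "emeasure (replicate_pmf n q) {xs. xs @ ys \<in> A} \<le> emeasure (replicate_pmf n p) {xs. xs @ ys \<in> A}" for ys
  proof (induction n arbitrary: ys)
    case 0
    then show ?case by simp
  next
    case (Suc n)
    define S where "S = (\<lambda>ys. {xs. xs @ ys \<in> A})"
    have snoc: "emeasure (bind_pmf r (\<lambda>x. bind_pmf (replicate_pmf n s) (\<lambda>xs. return_pmf (x # xs)))) (S ys) =
        (\<integral>\<^sup>+x. emeasure (replicate_pmf n s) (S (x # ys)) \<partial>r)" for r s :: "'a pmf"
    proof -
      have "x # xs \<in> S ys \<longleftrightarrow> xs \<in> S (x # ys)" for x xs
        unfolding S_def by (simp, rule perm) simp
      then have "(Cons x) -` S ys = S (x # ys)" for x by auto
      then show ?thesis by (simp flip: map_pmf_def)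
    qed
    have "emeasure (replicate_pmf (Suc n) q) (S ys) =
        emeasure (bind_pmf q (\<lambda>x. bind_pmf (replicate_pmf n q) (\<lambda>xs. return_pmf (x # xs)))) (S ys)"
      by simp
    \<comment> \<open>Drawing the head last makes \<open>step\<close> applicable conditionally on
      the tail. After the exchange the order is reversed again, so that the head is fixed and the
      induction hypothesis treats the tail.\<close>
    also have "\<dots> = emeasure (bind_pmf (replicate_pmf n q) (\<lambda>xs. bind_pmf q (\<lambda>x. return_pmf (x # xs)))) (S ys)"
      by (subst bind_commute_pmf) (rule refl)
    also have "\<dots> = (\<integral>\<^sup>+xs. emeasure q {x. x # (xs @ ys) \<in> A} \<partial>replicate_pmf n q)"
      by (simp flip: map_pmf_def add: S_def vimage_def)
    also have "\<dots> \<le> (\<integral>\<^sup>+xs. emeasure p {x. x # (xs @ ys) \<in> A} \<partial>replicate_pmf n q)"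
      by (intro nn_integral_mono step)
    also have "\<dots> = emeasure (bind_pmf (replicate_pmf n q) (\<lambda>xs. bind_pmf p (\<lambda>x. return_pmf (x # xs)))) (S ys)"
      by (simp flip: map_pmf_def add: S_def vimage_def)
    also have "\<dots> = emeasure (bind_pmf p (\<lambda>x. bind_pmf (replicate_pmf n q) (\<lambda>xs. return_pmf (x # xs)))) (S ys)"
      by (subst bind_commute_pmf) (rule refl)
    also have "\<dots> = (\<integral>\<^sup>+x. emeasure (replicate_pmf n q) (S (x # ys)) \<partial>p)"
      by (rule snoc)
    also have "\<dots> \<le> (\<integral>\<^sup>+x. emeasure (replicate_pmf n p) (S (x # ys)) \<partial>p)"
      unfolding S_def by (intro nn_integral_mono Suc.IH)
    also have "\<dots> = emeasure (replicate_pmf (Suc n) p) (S ys)"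
      by (simp only: snoc replicate_pmf.simps)
    finally show ?case
      unfolding S_def .
  qed
  from this[of "[]"] show ?thesis by simp
qed

section \<open>Independent draws from a mixture and the binomial split\<close>

lemma mset_replicate_pmf_Suc:
  "map_pmf mset (replicate_pmf (Suc n) p) =
     bind_pmf p (\<lambda>x. map_pmf (add_mset x) (map_pmf mset (replicate_pmf n p)))"
  by (simp add: map_pmf_def bind_assoc_pmf bind_return_pmf)

text \<open>Each draw first tosses a coin to choose its source, so the number of draws from
  \<open>P\<close> is binomial. Multisets are compared because on the right all draws from
  \<open>P\<close> come first, while on the left the sources are interleaved.\<close>

lemma mset_replicate_pmf_mixture:
  assumes p: "p \<in> {0..1}"
  shows "map_pmf mset (replicate_pmf n (bind_pmf (bernoulli_pmf p) (\<lambda>b. if b then P else Q))) =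
    bind_pmf (binomial_pmf n p) (\<lambda>k. bind_pmf (replicate_pmf k P) (\<lambda>xs.
      bind_pmf (replicate_pmf (n - k) Q) (\<lambda>ys. return_pmf (mset (xs @ ys)))))"
proof -
  define R where "R = (\<lambda>r k. map_pmf mset (replicate_pmf k (r :: 'a pmf)))"
  define J where "J = (\<lambda>k l. bind_pmf (R P k) (\<lambda>X. bind_pmf (R Q l) (\<lambda>Y. return_pmf (X + Y))))"
  have R_Suc: "R r (Suc k) = bind_pmf r (\<lambda>x. bind_pmf (R r k) (\<lambda>X. return_pmf (add_mset x X)))" for r k
    unfolding R_def mset_replicate_pmf_Suc by (simp add: map_pmf_def)
  have J1: "J (Suc k) l = bind_pmf P (\<lambda>x. map_pmf (add_mset x) (J k l))" for k l
    unfolding J_def R_Suc by (simp add: map_pmf_def bind_assoc_pmf bind_return_pmf)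
  have J2: "J k (Suc l) = bind_pmf Q (\<lambda>x. map_pmf (add_mset x) (J k l))" for k l
    unfolding J_def R_Suc
    by (simp add: map_pmf_def bind_assoc_pmf bind_return_pmf bind_commute_pmf[of "R P k" Q])
  let ?mix = "bind_pmf (bernoulli_pmf p) (\<lambda>b. if b then P else Q)"
  have "R ?mix n = bind_pmf (binomial_pmf n p) (\<lambda>k. J k (n - k))"
  proof (induction n)
    case 0
    then show ?case
      using p by (simp add: binomial_pmf_0 R_def J_def bind_return_pmf)
  next
    case (Suc n)
    have "R ?mix (Suc n) = bind_pmf (bernoulli_pmf p) (\<lambda>b. bind_pmf (if b then P else Q) (\<lambda>x.
        bind_pmf (binomial_pmf n p) (\<lambda>k. map_pmf (add_mset x) (J k (n - k)))))"
      by (simp add: R_Suc Suc.IH bind_assoc_pmf map_pmf_def)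
    also have "\<dots> = bind_pmf (bernoulli_pmf p) (\<lambda>b. bind_pmf (binomial_pmf n p) (\<lambda>k.
        bind_pmf (if b then P else Q) (\<lambda>x. map_pmf (add_mset x) (J k (n - k)))))"
      by (subst bind_commute_pmf) (rule refl)
    \<comment> \<open>The coin becomes an increment of the counter of \<open>P\<close> or of
      \<open>Q\<close>. The support bound \<open>k \<le> n\<close> makes \<open>Suc n - k\<close>
      the successor of \<open>n - k\<close> despite truncated subtraction.\<close>
    also have "\<dots> = bind_pmf (bernoulli_pmf p) (\<lambda>b. bind_pmf (binomial_pmf n p) (\<lambda>k.
        J ((if b then 1 else 0) + k) (Suc n - ((if b then 1 else 0) + k))))"
    proof (intro bind_pmf_cong refl)
      fix b k assume "k \<in> set_pmf (binomial_pmf n p)"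
      then have "k \<le> n"
        using p by (auto simp: set_pmf_binomial_eq split: if_splits)
      then show "bind_pmf (if b then P else Q) (\<lambda>x. map_pmf (add_mset x) (J k (n - k))) =
          J ((if b then 1 else 0) + k) (Suc n - ((if b then 1 else 0) + k))"
        by (simp add: J1 J2 Suc_diff_le)
    qed
    also have "\<dots> = bind_pmf (binomial_pmf (Suc n) p) (\<lambda>k. J k (Suc n - k))"
      using p by (simp add: binomial_pmf_Suc bind_assoc_pmf bind_return_pmf)
    finally show ?case .
  qed
  then show ?thesis
    by (simp add: R_def J_def map_pmf_def bind_assoc_pmf bind_return_pmf)
qed

text \<open>Layer-cake formula: \<open>f x - a\<close> is the integral over \<open>{a..b}\<close> of
  the indicator of \<open>t \<le> f x\<close>, and averaging over the finite support commutes with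
  the integral.\<close>

lemma has_integral_tail_prob:
  fixes f :: "'a \<Rightarrow> real"
  assumes fin: "finite (set_pmf p)" and bd: "\<And>x. x \<in> set_pmf p \<Longrightarrow> a \<le> f x \<and> f x \<le> b"
  shows "((\<lambda>t. measure_pmf.prob p {x. t \<le> f x}) has_integral measure_pmf.expectation p f - a) {a..b}"
proof -
  have "((\<lambda>t. \<Sum>x\<in>set_pmf p. pmf p x * indicator {a..f x} t) has_integral
      (\<Sum>x\<in>set_pmf p. pmf p x * (f x - a))) {a..b}"
  proof (intro has_integral_sum fin has_integral_mult_right)
    fix x assume "x \<in> set_pmf p"
    then have x: "a \<le> f x" "f x \<le> b" using bd by auto
    have "((\<lambda>t. 1::real) has_integral (f x - a)) {a..f x}"
      using has_integral_const_real[of "1::real" a "f x"] x by simp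
    then have "((\<lambda>t. if t \<in> {a..f x} then 1 else 0::real) has_integral (f x - a)) {a..b}"
      using x by (subst has_integral_restrict) auto
    then show "((indicator {a..f x} :: real \<Rightarrow> real) has_integral (f x - a)) {a..b}"
      by (simp add: indicator_def[abs_def] of_bool_def)
  qed
  moreover have "(\<Sum>x\<in>set_pmf p. pmf p x * (f x - a)) = measure_pmf.expectation p f - a"
  proof -
    have "measure_pmf.expectation p f = (\<Sum>x\<in>set_pmf p. f x * pmf p x)"
      by (rule integral_measure_pmf_real) (use fin in auto)
    moreover have "(\<Sum>x\<in>set_pmf p. pmf p x) = 1"
      by (rule sum_pmf_eq_1) (use fin in auto)
    ultimately show ?thesis
      by (simp add: algebra_simps sum_subtractf flip: sum_distrib_left)
  qed
  moreover have "(\<Sum>x\<in>set_pmf p. pmf p x * indicator {a..f x} t) = measure_pmf.prob p {x. t \<le> f x}"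
    if "t \<in> {a..b}" for t
  proof -
    have "measure_pmf.prob p {x. t \<le> f x} = measure_pmf.expectation p (indicator {x. t \<le> f x})"
      by simp
    also have "\<dots> = (\<Sum>x\<in>set_pmf p. indicator {x. t \<le> f x} x * pmf p x)"
      by (rule integral_measure_pmf_real) (use fin in auto)
    also have "\<dots> = (\<Sum>x\<in>set_pmf p. pmf p x * indicator {a..f x} t)"
      using that by (intro sum.cong) (auto simp: indicator_def)
    finally show ?thesis by simp
  qed
  ultimately show ?thesis
    by (metis (no_types, lifting) has_integral_eq)
qed

lemma expectation_mono_of_tails:
  fixes f :: "'a \<Rightarrow> real" and g :: "'b \<Rightarrow> real"
  assumes fin: "finite (set_pmf p)" "finite (set_pmf q)"
    and tail: "\<And>t. measure_pmf.prob p {x. t \<le> f x} \<le> measure_pmf.prob q {y. t \<le> g y}"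
  shows "measure_pmf.expectation p f \<le> measure_pmf.expectation q g"
proof -
  \<comment> \<open>All values of both variables lie between \<open>Min S\<close> and
    \<open>Max S\<close>, so both tails are integrated over one interval and the offset
    \<open>Min S\<close> cancels.\<close>
  define S where "S = f ` set_pmf p \<union> g ` set_pmf q"
  have S: "finite S" using fin by (simp add: S_def)
  have p: "((\<lambda>t. measure_pmf.prob p {x. t \<le> f x}) has_integral measure_pmf.expectation p f - Min S) {Min S..Max S}"
    by (rule has_integral_tail_prob[OF fin(1)]) (use S in \<open>auto simp: S_def\<close>)
  have q: "((\<lambda>t. measure_pmf.prob q {x. t \<le> g x}) has_integral measure_pmf.expectation q g - Min S) {Min S..Max S}"
    by (rule has_integral_tail_prob[OF fin(2)]) (use S in \<open>auto simp: S_def\<close>)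
  from has_integral_le[OF p q] tail show ?thesis by simp
qed

lemma power_convex_combination:
  fixes u v x y :: real
  assumes "0 \<le> u" "0 \<le> v" "u + v = 1" "0 \<le> x" "0 \<le> y"
  shows "(u * x + v * y) ^ k \<le> u * x ^ k + v * y ^ k"
proof -
  have "convex_on {0::real..} (\<lambda>x. x ^ k)"
    by (cases "even k") (auto intro: convex_power_odd convex_on_subset[OF convex_power_even])
  then show ?thesis
    using assms unfolding convex_on_def by auto
qed

subsection \<open>Edges violated by a set of assignments\<close>

text \<open>Separates the event on which an edge potential takes its lower value from the two values
  \<open>edge_lo\<close> and \<open>edge_hi\<close>, so that one argument serves all six models. The
  last equation covers MAX-CUT, Ising and coloring.\<close>

fun violated :: "model \<Rightarrow> bool list \<Rightarrow> nat list \<Rightarrow> bool" where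
  "violated IndSet a ys = (ys ! 0 = 1 \<and> ys ! 1 = 1)"
| "violated (KSAT K) a ys = (ys = map of_bool a)"
| "violated (NAEKSAT K) a ys = (ys = map of_bool a \<or> ys = map (\<lambda>b. of_bool (\<not> b)) a)"
| "violated _ a ys = (ys ! 0 = ys ! 1)"

fun edge_lo :: "model \<Rightarrow> ereal" where
  "edge_lo IndSet = - \<infinity>"
| "edge_lo (Ising \<beta> B) = ereal (- \<beta>)"
| "edge_lo _ = 0"

fun edge_hi :: "model \<Rightarrow> ereal" where
  "edge_hi IndSet = 0"
| "edge_hi (Ising \<beta> B) = ereal \<beta>"
| "edge_hi _ = 1"

lemma hedge_eq: "hedge m a ys = (if violated m a ys then edge_lo m else edge_hi m)"
  by (cases m) auto

lemma edge_lo_le_hi: "valid_model m \<Longrightarrow> edge_lo m \<le> edge_hi m"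
  by (cases m) auto

lemma arity_pos: "valid_model m \<Longrightarrow> 0 < arity m"
  by (cases m) auto

text \<open>The fibres of \<phi> partition \<open>V\<close>, so a nonempty list lies in at most one
  of them, and in one exactly when \<phi> is constant on it. An empty list would lie in every
  fibre.\<close>

lemma card_fibres_containing:
  fixes \<phi> :: "'a \<Rightarrow> 'b"
  assumes "set xs \<subseteq> V" "xs \<noteq> []"
  shows "card {C \<in> (\<lambda>i. {k \<in> V. \<phi> k = \<phi> i}) ` V. set xs \<subseteq> C} =
    of_bool (\<forall>i\<in>set xs. \<forall>j\<in>set xs. \<phi> i = \<phi> j)"
proof -
  define hom where "hom \<longleftrightarrow> (\<forall>i\<in>set xs. \<forall>j\<in>set xs. \<phi> i = \<phi> j)"
  have "card {C \<in> (\<lambda>i. {k \<in> V. \<phi> k = \<phi> i}) ` V. set xs \<subseteq> C} = of_bool hom"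
  proof (cases hom)
    case True
    have h: "hd xs \<in> set xs" using assms by simp
    have "{C \<in> (\<lambda>i. {k \<in> V. \<phi> k = \<phi> i}) ` V. set xs \<subseteq> C} = {{k \<in> V. \<phi> k = \<phi> (hd xs)}}"
    proof (intro equalityI subsetI)
      fix C assume "C \<in> {C \<in> (\<lambda>i. {k \<in> V. \<phi> k = \<phi> i}) ` V. set xs \<subseteq> C}"
      then show "C \<in> {{k \<in> V. \<phi> k = \<phi> (hd xs)}}" using h by auto
    next
      fix C assume "C \<in> {{k \<in> V. \<phi> k = \<phi> (hd xs)}}"
      then show "C \<in> {C \<in> (\<lambda>i. {k \<in> V. \<phi> k = \<phi> i}) ` V. set xs \<subseteq> C}"
        using h True assms(1) unfolding hom_def by blast
    qed
    then show ?thesis using True by simp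
  next
    case False
    then obtain i j where "i \<in> set xs" "j \<in> set xs" "\<phi> i \<noteq> \<phi> j"
      unfolding hom_def by blast
    then have "\<not> set xs \<subseteq> {k \<in> V. \<phi> k = \<phi> l}" for l
      by (metis (mono_tags, lifting) mem_Collect_eq subsetD)
    then have "{C \<in> (\<lambda>i. {k \<in> V. \<phi> k = \<phi> i}) ` V. set xs \<subseteq> C} = {}"
      by blast
    then show ?thesis using False by (simp only: card.empty of_bool_eq simp_thms)
  qed
  then show ?thesis
    unfolding hom_def .
qed

section \<open>Sign vectors violated by a whole set of assignments\<close>

lemma prob_uniform_signs:
  "measure_pmf.prob (pmf_of_set {a :: bool list. length a = K}) S = card ({a. length a = K} \<inter> S) / 2 ^ K"
proof -
  have f: "finite {a :: bool list. length a = K}" and c: "card {a :: bool list. length a = K} = 2 ^ K"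
    using finite_lists_length_eq[of "UNIV :: bool set" K] card_lists_length_eq[of "UNIV :: bool set" K]
    by auto
  have "{a :: bool list. length a = K} \<noteq> {}"
    using Ex_list_of_length by auto
  from measure_pmf_of_set[OF this f, of S] c show ?thesis by simp
qed

text \<open>Solves the violation condition for the sign vector: given the spins on
  \<open>xs\<close>, a single vector satisfies each equation. This turns later probabilities into
  counts of one or two vectors.\<close>

lemma map_eq_map_of_bool_iff:
  assumes "\<And>i. i \<in> set xs \<Longrightarrow> x i < (2 :: nat)"
  shows "map x xs = map of_bool a \<longleftrightarrow> a = map (\<lambda>i. x i = 1) xs"
    and "map x xs = map (\<lambda>b. of_bool (\<not> b)) a \<longleftrightarrow> a = map (\<lambda>i. x i \<noteq> 1) xs"
proof -
  have v: "x i = 0 \<or> x i = 1" if "i \<in> set xs" for i using assms[OF that] by linarith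
  show "map x xs = map of_bool a \<longleftrightarrow> a = map (\<lambda>i. x i = 1) xs"
  proof
    assume "map x xs = map of_bool a"
    then have "map (\<lambda>v. v = 1) (map x xs) = map (\<lambda>v. v = (1::nat)) (map of_bool a)" by simp
    then show "a = map (\<lambda>i. x i = 1) xs" by (simp add: comp_def)
  qed (use v in \<open>auto simp: comp_def\<close>)
  show "map x xs = map (\<lambda>b. of_bool (\<not> b)) a \<longleftrightarrow> a = map (\<lambda>i. x i \<noteq> 1) xs"
  proof
    assume "map x xs = map (\<lambda>b. of_bool (\<not> b)) a"
    then have "map (\<lambda>v. v \<noteq> 1) (map x xs) = map (\<lambda>v. v \<noteq> (1::nat)) (map (\<lambda>b. of_bool (\<not> b)) a)" by simp
    then show "a = map (\<lambda>i. x i \<noteq> 1) xs" by (simp add: comp_def)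
  qed (use v in \<open>auto simp: comp_def\<close>)
qed

text \<open>Violation by every assignment in \<open>X\<close> forces the sign vector to equal the
  spin pattern of each of them on \<open>xs\<close>. So all patterns coincide, meaning that
  \<open>xs\<close> consists of frozen nodes, and one vector out of \<open>2 ^ K\<close>
  remains.\<close>

lemma violation_prob_KSAT:
  fixes X :: "(nat \<Rightarrow> nat) set"
  assumes X: "\<And>x i. x \<in> X \<Longrightarrow> i \<in> V \<Longrightarrow> x i < 2"
    and x0: "x0 \<in> X" and xs: "set xs \<subseteq> V" "length xs = K"
  shows "measure_pmf.prob (sign_pmf (KSAT K)) {a. \<forall>x\<in>X. violated (KSAT K) a (map x xs)} =
    1 / 2 ^ K * of_bool (set xs \<subseteq> {i \<in> V. \<forall>x\<in>X. x i = x0 i})"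
proof -
  define F where "F = {i \<in> V. \<forall>x\<in>X. x i = x0 i}"
  have val: "x i < 2" if "x \<in> X" "i \<in> set xs" for x i using X that xs by auto
  have v: "violated (KSAT K) a (map x xs) \<longleftrightarrow> a = map (\<lambda>i. x i = 1) xs" if "x \<in> X" for a x
    using map_eq_map_of_bool_iff(1)[of xs x a] val[OF that] by simp
  have "{a. length a = K} \<inter> {a. \<forall>x\<in>X. violated (KSAT K) a (map x xs)} =
    (if set xs \<subseteq> F then {map (\<lambda>i. x0 i = 1) xs} else {})"
  proof (cases "set xs \<subseteq> F")
    case True
    have "map x xs = map x0 xs" if "x \<in> X" for x
      using True that unfolding F_def by (intro map_cong refl) blast
    then have "(\<forall>x\<in>X. violated (KSAT K) a (map x xs)) \<longleftrightarrow> violated (KSAT K) a (map x0 xs)" for a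
      using x0 by metis
    then show ?thesis using True xs(2) by (auto simp: v[OF x0] simp del: violated.simps)
  next
    case False
    then obtain i x where ix: "i \<in> set xs" "x \<in> X" "x i \<noteq> x0 i" using xs unfolding F_def by blast
    have "x i < 2" "x0 i < 2" using val ix x0 by auto
    then have "(x i = 1) \<noteq> (x0 i = 1)" using ix(3) by arith
    then have "map (\<lambda>i. x i = 1) xs \<noteq> map (\<lambda>i. x0 i = 1) xs"
      using ix(1) by auto
    then have "\<not> (\<forall>x\<in>X. violated (KSAT K) a (map x xs))" for a
      using ix(2) x0 v by metis
    then show ?thesis using False by auto
  qed
  then show ?thesis
    unfolding F_def[symmetric] by (simp add: sign_pmf_def prob_uniform_signs del: violated.simps)
qed

text \<open>As for K-SAT, but patterns are compared up to complement: on \<open>xs\<close> each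
  assignment in \<open>X\<close> must agree with \<open>x0\<close> everywhere or nowhere. Then two
  complementary sign vectors remain, distinct because \<open>K > 0\<close>.\<close>

lemma violation_prob_NAEKSAT:
  fixes X :: "(nat \<Rightarrow> nat) set"
  assumes X: "\<And>x i. x \<in> X \<Longrightarrow> i \<in> V \<Longrightarrow> x i < 2"
    and x0: "x0 \<in> X" and xs: "set xs \<subseteq> V" "length xs = K" "K > 0"
  shows "measure_pmf.prob (sign_pmf (NAEKSAT K)) {a. \<forall>x\<in>X. violated (NAEKSAT K) a (map x xs)} =
    2 / 2 ^ K * of_bool (\<forall>i\<in>set xs. \<forall>j\<in>set xs. \<forall>x\<in>X. (x i = x0 i) = (x j = x0 j))"
proof -
  define hom where "hom \<longleftrightarrow> (\<forall>i\<in>set xs. \<forall>j\<in>set xs. \<forall>x\<in>X. (x i = x0 i) = (x j = x0 j))"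
  have val: "x i < 2" if "x \<in> X" "i \<in> set xs" for x i using X that xs by auto
  have v: "violated (NAEKSAT K) a (map x xs) \<longleftrightarrow>
      a = map (\<lambda>i. x i = 1) xs \<or> a = map (\<lambda>i. x i \<noteq> 1) xs" if "x \<in> X" for a x
    using map_eq_map_of_bool_iff[of xs x a] val[OF that] by simp
  have flip: "x i = x0 i \<longleftrightarrow> (x i = 1) = (x0 i = 1)" if "x \<in> X" "i \<in> set xs" for x i
    using val[OF that] val[OF x0 that(2)] by arith
  have "{a. length a = K} \<inter> {a. \<forall>x\<in>X. violated (NAEKSAT K) a (map x xs)} =
    (if hom then {map (\<lambda>i. x0 i = 1) xs, map (\<lambda>i. x0 i \<noteq> 1) xs} else {})"
  proof (cases hom)
    case True
    have "violated (NAEKSAT K) a (map x xs) \<longleftrightarrow> violated (NAEKSAT K) a (map x0 xs)" if "x \<in> X" for a x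
    proof (cases "\<forall>i\<in>set xs. x i = x0 i")
      case True
      then have "map x xs = map x0 xs" by simp
      then show ?thesis by (simp only:)
    next
      case False
      then have "\<forall>i\<in>set xs. x i \<noteq> x0 i" using \<open>hom\<close> that unfolding hom_def by blast
      then have "map (\<lambda>i. x i = 1) xs = map (\<lambda>i. x0 i \<noteq> 1) xs"
        "map (\<lambda>i. x i \<noteq> 1) xs = map (\<lambda>i. x0 i = 1) xs"
        using flip[OF that] by auto
      then show ?thesis unfolding v[OF that] v[OF x0] by metis
    qed
    then have "(\<forall>x\<in>X. violated (NAEKSAT K) a (map x xs)) \<longleftrightarrow> violated (NAEKSAT K) a (map x0 xs)" for a
      using x0 by blast
    then show ?thesis using True xs(2) by (auto simp: v[OF x0] simp del: violated.simps)
  next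
    case False
    then obtain i j x where ix: "i \<in> set xs" "j \<in> set xs" "x \<in> X" "x i = x0 i" "x j \<noteq> x0 j"
      unfolding hom_def by blast
    then have b: "(x i = 1) = (x0 i = 1)" "(x j = 1) \<noteq> (x0 j = 1)" using flip by auto
    have "\<not> (violated (NAEKSAT K) a (map x xs) \<and> violated (NAEKSAT K) a (map x0 xs))" for a
      unfolding v[OF ix(3)] v[OF x0] using b ix(1,2) by (auto simp: map_eq_conv)
    then have "\<not> (\<forall>x\<in>X. violated (NAEKSAT K) a (map x xs))" for a
      using ix(3) x0 by blast
    then show ?thesis using False by auto
  qed
  moreover have "map (\<lambda>i. x0 i = 1) xs \<noteq> map (\<lambda>i. x0 i \<noteq> 1) xs"
    using xs by (cases xs) auto
  ultimately show ?thesis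
    unfolding hom_def[symmetric]
    by (simp add: sign_pmf_def prob_uniform_signs del: violated.simps map_eq_conv)
qed

text \<open>Brings all models to one shape: a constant times the number of classes containing the
  edge, with classes and constant independent of the edge. Counting edges class by class then
  produces \<open>arity m\<close>-th powers.\<close>

lemma violation_prob:
  fixes X :: "(nat \<Rightarrow> nat) set"
  assumes m: "valid_model m" and V: "finite V"
    and X: "\<forall>x\<in>X. \<forall>i\<in>V. x i < nstates m"
  obtains \<Phi> \<kappa> where "finite \<Phi>" "0 \<le> (\<kappa> :: real)"
    "\<And>xs. set xs \<subseteq> V \<Longrightarrow> length xs = arity m \<Longrightarrow>
      measure_pmf.prob (sign_pmf m) {a. \<forall>x\<in>X. violated m a (map x xs)} =
      \<kappa> * card {C \<in> \<Phi>. set xs \<subseteq> C}"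
proof -
  let ?P = "\<lambda>xs. measure_pmf.prob (sign_pmf m) {a. \<forall>x\<in>X. violated m a (map x xs)}"
  note result = that
  have one: thesis
    if \<kappa>: "0 \<le> \<kappa>"
      and P: "\<And>xs. set xs \<subseteq> V \<Longrightarrow> length xs = arity m \<Longrightarrow> ?P xs = \<kappa> * of_bool (set xs \<subseteq> F)"
    for F and \<kappa> :: real
  proof (rule result[of "{F}" \<kappa>])
    fix xs assume "set xs \<subseteq> V" "length xs = arity m"
    moreover have "{C \<in> {F}. set xs \<subseteq> C} = (if set xs \<subseteq> F then {F} else {})" by auto
    ultimately show "?P xs = \<kappa> * card {C \<in> {F}. set xs \<subseteq> C}"
      using P by simp
  qed (use \<kappa> in auto)
  have fibres: thesis
    if \<kappa>: "0 \<le> \<kappa>"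
      and P: "\<And>xs. set xs \<subseteq> V \<Longrightarrow> length xs = arity m \<Longrightarrow>
        ?P xs = \<kappa> * of_bool (\<forall>i\<in>set xs. \<forall>j\<in>set xs. \<forall>x\<in>X. \<psi> i x = \<psi> j x)"
    for \<psi> :: "nat \<Rightarrow> (nat \<Rightarrow> nat) \<Rightarrow> nat" and \<kappa> :: real
  proof -
    \<comment> \<open>Restricting to \<open>X\<close> turns agreement on all of \<open>X\<close>
      into plain equality of functions, so the classes are fibres of a single map.\<close>
    define \<phi> where "\<phi> = (\<lambda>i. restrict (\<psi> i) X)"
    have \<phi>: "(\<forall>x\<in>X. \<psi> i x = \<psi> j x) \<longleftrightarrow> \<phi> i = \<phi> j" for i j
      by (auto simp: \<phi>_def restrict_def fun_eq_iff)
    show thesis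
    proof (rule result[of "(\<lambda>i. {k \<in> V. \<phi> k = \<phi> i}) ` V" \<kappa>])
      fix xs assume xs: "set xs \<subseteq> V" "length xs = arity m"
      then have "xs \<noteq> []" using arity_pos[OF m] by auto
      from P[OF xs] card_fibres_containing[OF xs(1) this, of \<phi>]
      show "?P xs = \<kappa> * card {C \<in> (\<lambda>i. {k \<in> V. \<phi> k = \<phi> i}) ` V. set xs \<subseteq> C}"
        by (simp only: \<phi> of_nat_of_bool)
    qed (use V \<kappa> in auto)
  qed
  have pair: "\<exists>i j. xs = [i, j]" if "length xs = 2" for xs :: "nat list"
    using that by (auto simp: length_Suc_conv numeral_2_eq_2)
  have two_spin: thesis if "arity m = 2" "sign_pmf m = return_pmf b"
    "\<And>a ys. violated m a ys \<longleftrightarrow> ys ! 0 = ys ! 1" for b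
  proof (rule fibres[of 1 "\<lambda>i x. x i"])
    fix xs :: "nat list" assume "length xs = arity m"
    with that(1) obtain i j where xs: "xs = [i, j]" using pair by metis
    have hom: "(\<forall>i\<in>set xs. \<forall>j\<in>set xs. \<forall>x\<in>X. x i = x j) \<longleftrightarrow> (\<forall>x\<in>X. x i = x j)"
    proof (intro iffI ballI)
      fix k l x assume "\<forall>x\<in>X. x i = x j" "x \<in> X" and kl: "k \<in> set xs" "l \<in> set xs"
      then have "x i = x j" by blast
      with kl show "x k = x l" by (auto simp: xs)
    next
      have "i \<in> set xs" "j \<in> set xs" by (simp_all add: xs)
      moreover fix x assume "\<forall>i\<in>set xs. \<forall>j\<in>set xs. \<forall>x\<in>X. x i = x j" "x \<in> X"
      ultimately show "x i = x j" by blast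
    qed
    show "?P xs = 1 * of_bool (\<forall>i\<in>set xs. \<forall>j\<in>set xs. \<forall>x\<in>X. x i = x j)"
      unfolding hom by (simp add: xs that(2,3) indicator_def)
  qed simp
  show thesis
  proof (cases "X = {}")
    case True
    \<comment> \<open>With \<open>X\<close> empty every edge is vacuously violated, which is the
      case of the single class \<open>V\<close> and constant 1.\<close>
    show ?thesis
    proof (rule one[of 1 V])
      fix xs :: "nat list" assume "set xs \<subseteq> V"
      then show "?P xs = 1 * of_bool (set xs \<subseteq> V)" using True by simp
    qed simp
  next
    case False
    then obtain x0 where x0: "x0 \<in> X" by auto
    show ?thesis
    proof (cases m)
      case IndSet
      show ?thesis
      \<comment> \<open>Only nodes frozen at spin 1 belong to the class; nodes frozen at 0 never
        violate an edge.\<close>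
      proof (rule one[of 1 "{i \<in> V. \<forall>x\<in>X. x i = 1}"])
        fix xs assume xs: "set xs \<subseteq> V" "length xs = arity m"
        with IndSet obtain i j where "xs = [i, j]" using pair[of xs] by auto
        then show "?P xs = 1 * of_bool (set xs \<subseteq> {i \<in> V. \<forall>x\<in>X. x i = 1})"
          using xs(1) by (auto simp: IndSet sign_pmf_def indicator_def)
      qed simp
    next
      case (KSAT K)
      show ?thesis
      proof (rule one[of "1 / 2 ^ K" "{i \<in> V. \<forall>x\<in>X. x i = x0 i}"])
        fix xs assume xs: "set xs \<subseteq> V" "length xs = arity m"
        have "x i < 2" if "x \<in> X" "i \<in> V" for x i using X that KSAT by auto
        moreover have "length xs = K" using xs KSAT by simp
        ultimately show "?P xs = 1 / 2 ^ K * of_bool (set xs \<subseteq> {i \<in> V. \<forall>x\<in>X. x i = x0 i})"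
          unfolding KSAT using violation_prob_KSAT[OF _ x0 xs(1)] by blast
      qed simp
    next
      case (NAEKSAT K)
      show ?thesis
      \<comment> \<open>The label of a node records which assignments agree with \<open>x0\<close>
        there, that is, its flips relative to \<open>x0\<close>.\<close>
      proof (rule fibres[of "2 / 2 ^ K" "\<lambda>i x. of_bool (x i = x0 i)"])
        fix xs assume xs: "set xs \<subseteq> V" "length xs = arity m"
        have "x i < 2" if "x \<in> X" "i \<in> V" for x i using X that NAEKSAT by auto
        moreover have "length xs = K" "K > 0" using xs NAEKSAT m by auto
        ultimately have "?P xs = 2 / 2 ^ K *
            of_bool (\<forall>i\<in>set xs. \<forall>j\<in>set xs. \<forall>x\<in>X. (x i = x0 i) = (x j = x0 j))"
          unfolding NAEKSAT using violation_prob_NAEKSAT[OF _ x0 xs(1)] by blast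
        then show "?P xs = 2 / 2 ^ K * of_bool (\<forall>i\<in>set xs. \<forall>j\<in>set xs. \<forall>x\<in>X.
            of_bool (x i = x0 i) = (of_bool (x j = x0 j) :: nat))"
          by (simp only: of_bool_eq_iff)
      qed simp
    qed (rule two_spin; simp add: sign_pmf_def)+
  qed
qed

section \<open>Violation probability of a uniform edge as a sum of powers\<close>

lemma prob_pair_pmf_of_set:
  assumes "A \<noteq> {}" "finite A"
  shows "measure_pmf.prob (pair_pmf (pmf_of_set A) q) S = (\<Sum>x\<in>A. measure_pmf.prob q {y. (x, y) \<in> S}) / card A"
proof -
  have "ennreal (measure_pmf.prob (pair_pmf (pmf_of_set A) q) S) = emeasure (pair_pmf (pmf_of_set A) q) S"
    by (simp add: measure_pmf.emeasure_eq_measure)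
  also have "\<dots> = (\<Sum>x\<in>A. emeasure q {y. (x, y) \<in> S}) / card A"
    using assms by (simp add: pair_pmf_def nn_integral_pmf_of_set vimage_def flip: map_pmf_def)
  also have "\<dots> = ennreal ((\<Sum>x\<in>A. measure_pmf.prob q {y. (x, y) \<in> S}) / card A)"
    using assms by (simp add: measure_pmf.emeasure_eq_measure sum_ennreal divide_ennreal sum_nonneg
        card_gt_0_iff ennreal_of_nat_eq_real_of_nat)
  finally show ?thesis
    by (simp add: sum_nonneg)
qed

text \<open>Double counting: after exchanging the sums, each class \<open>C\<close> contributes the
  number of node lists inside \<open>C \<inter> W\<close>. The sign hypothesis concerns the large
  set \<open>V\<close>, so the same \<Phi> and \<kappa> serve every \<open>W\<close> inside
  it.\<close>

lemma prob_edge_pmf_eq_sum_powers: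
  fixes \<kappa> :: real
  assumes W: "W \<subseteq> V" "W \<noteq> {}" "finite V" and \<Phi>: "finite \<Phi>"
    and sign: "\<And>xs. set xs \<subseteq> V \<Longrightarrow> length xs = arity m \<Longrightarrow>
      measure_pmf.prob (sign_pmf m) {a. (xs, a) \<in> S} = \<kappa> * card {C \<in> \<Phi>. set xs \<subseteq> C}"
  shows "measure_pmf.prob (edge_pmf m W) S = \<kappa> * (\<Sum>C\<in>\<Phi>. (card (C \<inter> W) / card W) ^ arity m)"
proof -
  define L where "L = (\<lambda>U. {xs :: nat list. set xs \<subseteq> U \<and> length xs = arity m})"
  have fW: "finite W" using W finite_subset by auto
  have L: "finite (L U)" "card (L U) = card U ^ arity m" if "U \<subseteq> W" for U
    using finite_lists_length_eq[of U "arity m"] card_lists_length_eq[of U "arity m"]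
      finite_subset[OF that fW] by (auto simp: L_def)
  obtain w where w: "w \<in> W" using W by auto
  have "replicate (arity m) w \<in> L W" using w by (auto simp: L_def)
  then have ne: "L W \<noteq> {}" by auto
  have "(\<Sum>xs\<in>L W. real (card {C \<in> \<Phi>. set xs \<subseteq> C})) = (\<Sum>xs\<in>L W. \<Sum>C\<in>\<Phi>. of_bool (set xs \<subseteq> C))"
    using \<Phi> by (intro sum.cong refl) (simp add: Int_def)
  also have "\<dots> = (\<Sum>C\<in>\<Phi>. \<Sum>xs\<in>L W. of_bool (set xs \<subseteq> C))"
    by (rule sum.swap)
  also have "\<dots> = (\<Sum>C\<in>\<Phi>. real (card (C \<inter> W)) ^ arity m)"
  proof (intro sum.cong refl)
    fix C
    have "L W \<inter> {xs. set xs \<subseteq> C} = L (C \<inter> W)" by (auto simp: L_def)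
    then show "(\<Sum>xs\<in>L W. of_bool (set xs \<subseteq> C)) = real (card (C \<inter> W)) ^ arity m"
      using L[of W] L[of "C \<inter> W"] by simp
  qed
  finally have *: "(\<Sum>xs\<in>L W. real (card {C \<in> \<Phi>. set xs \<subseteq> C})) = (\<Sum>C\<in>\<Phi>. real (card (C \<inter> W)) ^ arity m)" .
  have "measure_pmf.prob (edge_pmf m W) S = (\<Sum>xs\<in>L W. measure_pmf.prob (sign_pmf m) {a. (xs, a) \<in> S}) / card (L W)"
    using prob_pair_pmf_of_set[OF ne L(1), of "sign_pmf m" S] by (simp add: edge_pmf_def L_def)
  also have "(\<Sum>xs\<in>L W. measure_pmf.prob (sign_pmf m) {a. (xs, a) \<in> S}) =
      (\<Sum>xs\<in>L W. \<kappa> * real (card {C \<in> \<Phi>. set xs \<subseteq> C}))"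
    using W by (intro sum.cong refl sign) (auto simp: L_def)
  also have "\<dots> = \<kappa> * (\<Sum>C\<in>\<Phi>. real (card (C \<inter> W)) ^ arity m)"
    unfolding *[symmetric] by (simp add: sum_distrib_left)
  finally show ?thesis
    using L[of W] by (simp add: power_divide flip: sum_divide_distrib)
qed

subsection \<open>Exchanging uniform edges for mixed edges\<close>

lemma rgraph_eq_replicate_pmf: "rgraph m V M = replicate_pmf M (edge_pmf m V)"
  by (induction M) (simp_all add: map_pmf_def)

lemma nstates_pos: "valid_model m \<Longrightarrow> 0 < nstates m"
  by (cases m) auto

lemma finite_nonempty_assignments:
  assumes "valid_model m" "finite V"
  shows "finite (PiE V (\<lambda>_. {..<nstates m}))" "PiE V (\<lambda>_. {..<nstates m}) \<noteq> {}"
  using assms nstates_pos[of m] by (auto simp: PiE_eq_empty_iff lessThan_empty_iff intro!: finite_PiE)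

lemma le_HG_iff:
  assumes "valid_model m" "finite V"
  shows "t \<le> HG m V E \<longleftrightarrow> (\<exists>x \<in> PiE V (\<lambda>_. {..<nstates m}). t \<le> Hx m V E x)"
  unfolding HG_def using finite_nonempty_assignments[OF assms] by (subst Max_ge_iff) auto

lemma HG_perm:
  assumes "mset E = mset E'"
  shows "HG m V E = HG m V E'"
proof -
  have "(\<Sum>e\<leftarrow>E. g e) = (\<Sum>e\<leftarrow>E'. g e)" for g :: "edge \<Rightarrow> ereal"
    by (simp flip: sum_mset_sum_list add: assms)
  then show ?thesis by (simp add: HG_def Hx_def[abs_def])
qed

text \<open>The law of one edge whose independent copies form, up to order, the disjoint union of
  the two random graphs with binomial edge numbers.\<close>

definition mixed_edge :: "model \<Rightarrow> nat set \<Rightarrow> nat set \<Rightarrow> real \<Rightarrow> edge pmf" where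
  "mixed_edge m V1 V2 p = bind_pmf (bernoulli_pmf p) (\<lambda>b. if b then edge_pmf m V1 else edge_pmf m V2)"

lemma prob_mixed_edge:
  assumes "0 \<le> p" "p \<le> 1"
  shows "measure_pmf.prob (mixed_edge m V1 V2 p) S =
    p * measure_pmf.prob (edge_pmf m V1) S + (1 - p) * measure_pmf.prob (edge_pmf m V2) S"
proof -
  have "ennreal (measure_pmf.prob (mixed_edge m V1 V2 p) S) = emeasure (mixed_edge m V1 V2 p) S"
    by (simp add: measure_pmf.emeasure_eq_measure)
  also have "\<dots> = ennreal p * emeasure (edge_pmf m V1) S + ennreal (1 - p) * emeasure (edge_pmf m V2) S"
    using assms by (simp add: mixed_edge_def mult.commute)
  also have "\<dots> = ennreal (p * measure_pmf.prob (edge_pmf m V1) S + (1 - p) * measure_pmf.prob (edge_pmf m V2) S)"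
    using assms by (simp add: measure_pmf.emeasure_eq_measure ennreal_mult)
  finally show ?thesis
    by (subst (asm) ennreal_inj) (use assms in auto)
qed

text \<open>The density of a class in the union is the average of its densities in \<open>V1\<close>
  and \<open>V2\<close> with weights \<open>p\<close> and \<open>1 - p\<close>. Convexity of the
  power compares the two sides class by class.\<close>

lemma prob_violated_le_mixed:
  fixes X :: "(nat \<Rightarrow> nat) set"
  assumes m: "valid_model m" and V: "finite V1" "finite V2" "V1 \<noteq> {}" "V2 \<noteq> {}" "V1 \<inter> V2 = {}"
    and X: "\<forall>x\<in>X. \<forall>i\<in>V1 \<union> V2. x i < nstates m"
  defines "S \<equiv> {e. \<forall>x\<in>X. violated m (snd e) (map x (fst e))}"
    and "p \<equiv> real (card V1) / real (card (V1 \<union> V2))"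
  shows "measure_pmf.prob (edge_pmf m (V1 \<union> V2)) S \<le> measure_pmf.prob (mixed_edge m V1 V2 p) S"
proof -
  let ?V = "V1 \<union> V2"
  have fV: "finite ?V" using V by simp
  obtain \<Phi> \<kappa> where \<Phi>: "finite \<Phi>" and \<kappa>: "0 \<le> (\<kappa> :: real)"
    and sign: "\<And>xs. set xs \<subseteq> ?V \<Longrightarrow> length xs = arity m \<Longrightarrow>
      measure_pmf.prob (sign_pmf m) {a. \<forall>x\<in>X. violated m a (map x xs)} = \<kappa> * card {C \<in> \<Phi>. set xs \<subseteq> C}"
    by (rule violation_prob[OF m fV X]) (rule that)
  have P: "measure_pmf.prob (edge_pmf m W) S = \<kappa> * (\<Sum>C\<in>\<Phi>. (card (C \<inter> W) / card W) ^ arity m)"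
    if "W \<subseteq> ?V" "W \<noteq> {}" for W
    by (rule prob_edge_pmf_eq_sum_powers[OF that fV \<Phi>]) (simp add: S_def sign)
  have c: "card ?V = card V1 + card V2" "card V1 > 0" "card V2 > 0"
    using V by (auto simp: card_Un_disjoint card_gt_0_iff)
  have p: "0 \<le> p" "p \<le> 1" "1 - p = card V2 / card ?V"
    using c by (auto simp: p_def field_simps)
  have "(card (C \<inter> ?V) / card ?V) ^ arity m \<le>
      p * (card (C \<inter> V1) / card V1) ^ arity m + (1 - p) * (card (C \<inter> V2) / card V2) ^ arity m" for C
  proof -
    have "card (C \<inter> ?V) = card (C \<inter> V1) + card (C \<inter> V2)"
      unfolding Int_Un_distrib using V by (intro card_Un_disjoint) auto
    then have "card (C \<inter> ?V) / card ?V = p * (card (C \<inter> V1) / card V1) + (1 - p) * (card (C \<inter> V2) / card V2)"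
      unfolding p(3) using c by (simp add: p_def add_divide_distrib)
    then show ?thesis
      using power_convex_combination[of p "1 - p" "card (C \<inter> V1) / card V1" "card (C \<inter> V2) / card V2" "arity m"] p
      by simp
  qed
  then have "(\<Sum>C\<in>\<Phi>. (card (C \<inter> ?V) / card ?V) ^ arity m) \<le>
      p * (\<Sum>C\<in>\<Phi>. (card (C \<inter> V1) / card V1) ^ arity m) + (1 - p) * (\<Sum>C\<in>\<Phi>. (card (C \<inter> V2) / card V2) ^ arity m)"
    unfolding sum_distrib_left sum.distrib[symmetric] by (intro sum_mono)
  from mult_left_mono[OF this \<kappa>] show ?thesis
    using p(1,2) V by (simp add: prob_mixed_edge P algebra_simps)
qed

text \<open>The exchange of one edge on top of an arbitrary edge list \<open>E\<close>: the event of
  reaching \<open>t\<close> is either certain or the complement of a violation event as in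
  \<open>prob_violated_le_mixed\<close>.\<close>

lemma mixed_edge_tail_le:
  assumes m: "valid_model m" and V: "finite V1" "finite V2" "V1 \<noteq> {}" "V2 \<noteq> {}" "V1 \<inter> V2 = {}"
  defines "p \<equiv> real (card V1) / real (card (V1 \<union> V2))"
  shows "emeasure (mixed_edge m V1 V2 p) {e. ereal t \<le> HG m (V1 \<union> V2) (e # E)} \<le>
    emeasure (edge_pmf m (V1 \<union> V2)) {e. ereal t \<le> HG m (V1 \<union> V2) (e # E)}"
proof -
  let ?V = "V1 \<union> V2" and ?A = "PiE (V1 \<union> V2) (\<lambda>_. {..<nstates m})"
  let ?T = "{e. ereal t \<le> HG m (V1 \<union> V2) (e # E)}"
  have Hx_Cons: "Hx m ?V (e # E) x = Hx m ?V E x + hedge m (snd e) (map x (fst e))" for e x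
    by (simp add: Hx_def ac_simps)
  have T: "e \<in> ?T \<longleftrightarrow> (\<exists>x\<in>?A. ereal t \<le> Hx m ?V E x + hedge m (snd e) (map x (fst e)))" for e
    using le_HG_iff[OF m, of ?V "ereal t" "e # E"] V by (simp add: Hx_Cons)
  show ?thesis
  proof (cases "\<exists>x\<in>?A. ereal t \<le> Hx m ?V E x + edge_lo m")
    case True
    then obtain x where x: "x \<in> ?A" "ereal t \<le> Hx m ?V E x + edge_lo m" by blast
    have "Hx m ?V E x + edge_lo m \<le> Hx m ?V E x + hedge m (snd e) (map x (fst e))" for e
      using edge_lo_le_hi[OF m] by (intro add_left_mono) (simp add: hedge_eq)
    then have "?T = UNIV" using x T by (auto intro: order.trans)
    then show ?thesis by (simp add: emeasure_pmf)
  next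
    case False
    \<comment> \<open>These assignments reach \<open>t\<close> when the new edge is not violated. By
      the case assumption none reaches it with a violated edge, so \<open>t\<close> is missed
      exactly when the edge is violated throughout \<open>X\<close>.\<close>
    define X where "X = {x \<in> ?A. ereal t \<le> Hx m ?V E x + edge_hi m}"
    let ?S = "{e. \<forall>x\<in>X. violated m (snd e) (map x (fst e))}"
    have T_eq: "?T = - ?S"
    proof (intro set_eqI)
      fix e
      show "e \<in> ?T \<longleftrightarrow> e \<in> - ?S"
        using False unfolding T hedge_eq X_def by (auto split: if_splits)
    qed
    have "measure_pmf.prob (edge_pmf m ?V) ?S \<le> measure_pmf.prob (mixed_edge m V1 V2 p) ?S"
      unfolding p_def by (rule prob_violated_le_mixed[OF m V]) (auto simp: X_def PiE_iff)
    then show ?thesis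
      unfolding T_eq measure_pmf.emeasure_eq_measure
      using measure_pmf.prob_compl[of ?S "edge_pmf m ?V"] measure_pmf.prob_compl[of ?S "mixed_edge m V1 V2 p"]
      by (intro ennreal_leI) (simp add: Compl_eq_Diff_UNIV)
  qed
qed

text \<open>The two edge lists are kept apart so that both marginals and the concatenation can be
  read off from one distribution.\<close>

definition split_graphs :: "model \<Rightarrow> nat set \<Rightarrow> nat set \<Rightarrow> real \<Rightarrow> nat \<Rightarrow> (edge list \<times> edge list) pmf" where
  "split_graphs m V1 V2 p n = bind_pmf (binomial_pmf n p) (\<lambda>k. pair_pmf (rgraph m V1 k) (rgraph m V2 (n - k)))"

lemma prob_split_graphs_tail_le:
  assumes m: "valid_model m" and V: "finite V1" "finite V2" "V1 \<noteq> {}" "V2 \<noteq> {}" "V1 \<inter> V2 = {}"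
  defines "p \<equiv> real (card V1) / real (card (V1 \<union> V2))"
  shows "measure_pmf.prob (split_graphs m V1 V2 p n) {(E1, E2). ereal t \<le> HG m (V1 \<union> V2) (E1 @ E2)} \<le>
    measure_pmf.prob (rgraph m (V1 \<union> V2) n) {E. ereal t \<le> HG m (V1 \<union> V2) E}"
proof -
  let ?A = "{E. ereal t \<le> HG m (V1 \<union> V2) E}"
  have p: "p \<in> {0..1}"
    unfolding p_def using V card_mono[of "V1 \<union> V2" V1] by (auto simp: divide_le_eq_1)
  \<comment> \<open>The tail event is a union of fibres of \<open>mset\<close>, so passing to
    multisets does not change its probability.\<close>
  have A: "mset -` (mset ` ?A) = ?A"
  proof (intro equalityI subsetI)
    fix E assume "E \<in> mset -` (mset ` ?A)"
    then obtain E' where "mset E = mset E'" "E' \<in> ?A" by auto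
    then show "E \<in> ?A" using HG_perm[of E E' m "V1 \<union> V2"] by simp
  qed auto
  have "map_pmf mset (replicate_pmf n (mixed_edge m V1 V2 p)) =
      map_pmf (\<lambda>(E1, E2). mset (E1 @ E2)) (split_graphs m V1 V2 p n)"
    unfolding mixed_edge_def mset_replicate_pmf_mixture[OF p] split_graphs_def rgraph_eq_replicate_pmf
    by (simp add: map_pmf_def pair_pmf_def bind_assoc_pmf bind_return_pmf)
  then have "emeasure (map_pmf mset (replicate_pmf n (mixed_edge m V1 V2 p))) (mset ` ?A) =
      emeasure (map_pmf (\<lambda>(E1, E2). mset (E1 @ E2)) (split_graphs m V1 V2 p n)) (mset ` ?A)"
    by simp
  moreover have "(\<lambda>(E1, E2). mset (E1 @ E2)) -` (mset ` ?A) = {(E1, E2). E1 @ E2 \<in> mset -` (mset ` ?A)}"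
    by auto
  ultimately have "emeasure (replicate_pmf n (mixed_edge m V1 V2 p)) ?A =
      emeasure (split_graphs m V1 V2 p n) {(E1, E2). ereal t \<le> HG m (V1 \<union> V2) (E1 @ E2)}"
    unfolding emeasure_map_pmf A by simp
  moreover have "emeasure (replicate_pmf n (mixed_edge m V1 V2 p)) ?A \<le>
      emeasure (replicate_pmf n (edge_pmf m (V1 \<union> V2))) ?A"
  proof (rule emeasure_replicate_pmf_mono)
    show "emeasure (mixed_edge m V1 V2 p) {e. e # E \<in> ?A} \<le> emeasure (edge_pmf m (V1 \<union> V2)) {e. e # E \<in> ?A}" for E
      using mixed_edge_tail_le[OF m V, of t E] by (simp add: p_def)
    show "E \<in> ?A \<longleftrightarrow> E' \<in> ?A" if "mset E = mset E'" for E E'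
      using HG_perm[OF that] by simp
  qed
  ultimately show ?thesis
    by (simp add: rgraph_eq_replicate_pmf measure_pmf.emeasure_eq_measure)
qed


subsection \<open>Disjoint unions and relabelling\<close>

text \<open>The length condition ensures that the list lookups in \<open>hedge\<close> hit actual
  nodes of the edge.\<close>

definition wf_graph :: "model \<Rightarrow> nat set \<Rightarrow> edge list \<Rightarrow> bool" where
  "wf_graph m V E \<longleftrightarrow> (\<forall>e\<in>set E. set (fst e) \<subseteq> V \<and> length (fst e) = arity m)"

lemma Hx_cong:
  assumes "wf_graph m V E" "\<And>i. i \<in> V \<Longrightarrow> x i = y i"
  shows "Hx m V E x = Hx m V E y"
proof -
  have "hedge m (snd e) (map x (fst e)) = hedge m (snd e) (map y (fst e))" if "e \<in> set E" for e
  proof -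
    have "map x (fst e) = map y (fst e)"
      using assms that by (auto simp: wf_graph_def)
    then show ?thesis by (simp only:)
  qed
  then have "(\<Sum>e\<leftarrow>E. hedge m (snd e) (map x (fst e))) = (\<Sum>e\<leftarrow>E. hedge m (snd e) (map y (fst e)))"
    by (intro arg_cong[where f = sum_list] map_cong refl)
  moreover have "(\<Sum>i\<in>V. hnode m (x i)) = (\<Sum>i\<in>V. hnode m (y i))"
    by (rule sum.cong) (use assms in auto)
  ultimately show ?thesis by (simp add: Hx_def)
qed

lemma HG_attained:
  assumes "valid_model m" "finite V"
  obtains x where "x \<in> PiE V (\<lambda>_. {..<nstates m})" "HG m V E = Hx m V E x"
proof -
  have "HG m V E \<in> Hx m V E ` PiE V (\<lambda>_. {..<nstates m})"
    unfolding HG_def using finite_nonempty_assignments[OF assms] by (intro Max_in) auto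
  then show thesis using that by auto
qed

lemma Hx_le_HG:
  assumes "valid_model m" "finite V" "x \<in> PiE V (\<lambda>_. {..<nstates m})"
  shows "Hx m V E x \<le> HG m V E"
  using assms le_HG_iff by blast

text \<open>No potential is ever \<infinity>, which bounds the maximum from above. From below the
  all-zero assignment suffices, since it avoids the only value \<open>- \<infinity>\<close>, that of
  an edge with both ends at spin 1.\<close>

lemma HG_finite:
  assumes m: "valid_model m" and V: "finite V" and E: "wf_graph m V E"
  shows "\<bar>HG m V E\<bar> \<noteq> \<infinity>"
proof -
  have node: "\<bar>hnode m v\<bar> \<noteq> \<infinity>" for v
    by (cases m) auto
  have edge: "hedge m a ys \<noteq> \<infinity>" for a ys
    by (cases m) auto
  have sum_list_inf: "(\<Sum>e\<leftarrow>F. g e) \<noteq> \<infinity>" if "\<And>e. e \<in> set F \<Longrightarrow> g e \<noteq> \<infinity>"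
    for F :: "edge list" and g :: "edge \<Rightarrow> ereal"
    using that by (induction F) auto
  have sum_list_minf: "(\<Sum>e\<leftarrow>F. g e) \<noteq> - \<infinity>" if "\<And>e. e \<in> set F \<Longrightarrow> g e \<noteq> - \<infinity>"
    for F :: "edge list" and g :: "edge \<Rightarrow> ereal"
    using that by (induction F) auto
  have "\<bar>\<Sum>i\<in>V. hnode m (x i)\<bar> \<noteq> \<infinity>" for x
    using node by (auto simp: sum_Inf)
  then have nodes: "(\<Sum>i\<in>V. hnode m (x i)) \<noteq> \<infinity>" "(\<Sum>i\<in>V. hnode m (x i)) \<noteq> - \<infinity>" for x
    by (metis abs_ereal.simps(2,3))+
  have "Hx m V E x \<noteq> \<infinity>" for x
    unfolding Hx_def using nodes(1) sum_list_inf edge by auto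
  then have "HG m V E \<noteq> \<infinity>"
    using HG_attained[OF m V] by metis
  moreover have "HG m V E \<noteq> - \<infinity>"
  proof -
    define x where "x = (\<lambda>i\<in>V. 0 :: nat)"
    have "hedge m (snd e) (map x (fst e)) \<noteq> - \<infinity>" if "e \<in> set E" for e
    proof (cases m)
      case IndSet
      then have "set (fst e) \<subseteq> V" "length (fst e) = 2" using E that by (auto simp: wf_graph_def)
      then have "map x (fst e) ! 0 = 0" by (auto simp: x_def subset_iff)
      then show ?thesis using IndSet by simp
    qed auto
    then have "Hx m V E x \<noteq> - \<infinity>"
      unfolding Hx_def using nodes(2)[of x] sum_list_minf by simp
    moreover have "Hx m V E x \<le> HG m V E"
      by (rule Hx_le_HG[OF m V]) (use nstates_pos[OF m] in \<open>auto simp: x_def\<close>)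
    ultimately show ?thesis by auto
  qed
  ultimately show ?thesis by auto
qed

text \<open>The energy splits over the two node sets, which can be maximised separately: restricting
  an optimum gives one inequality, gluing two optima the other.\<close>

lemma HG_disjoint_union:
  assumes m: "valid_model m" and V: "finite V1" "finite V2" "V1 \<inter> V2 = {}"
    and E: "wf_graph m V1 E1" "wf_graph m V2 E2"
  shows "HG m (V1 \<union> V2) (E1 @ E2) = HG m V1 E1 + HG m V2 E2"
proof -
  let ?A = "\<lambda>V. PiE V (\<lambda>_. {..<nstates m})"
  have add: "Hx m (V1 \<union> V2) (E1 @ E2) x = Hx m V1 E1 x + Hx m V2 E2 x" for x
    using V by (simp add: Hx_def sum.union_disjoint ac_simps)
  show ?thesis
  proof (rule antisym)
    obtain x where x: "x \<in> ?A (V1 \<union> V2)" "HG m (V1 \<union> V2) (E1 @ E2) = Hx m (V1 \<union> V2) (E1 @ E2) x"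
      using HG_attained[OF m] V by (metis finite_Un)
    have "Hx m V1 E1 x = Hx m V1 E1 (restrict x V1)" "Hx m V2 E2 x = Hx m V2 E2 (restrict x V2)"
      using E by (auto intro: Hx_cong)
    moreover have "restrict x V1 \<in> ?A V1" "restrict x V2 \<in> ?A V2" using x(1) by auto
    ultimately have "Hx m V1 E1 x \<le> HG m V1 E1" "Hx m V2 E2 x \<le> HG m V2 E2"
      using Hx_le_HG[OF m] V by metis+
    then show "HG m (V1 \<union> V2) (E1 @ E2) \<le> HG m V1 E1 + HG m V2 E2"
      unfolding x(2) add by (rule add_mono)
  next
    obtain x1 where x1: "x1 \<in> ?A V1" "HG m V1 E1 = Hx m V1 E1 x1" using HG_attained[OF m V(1)] .
    obtain x2 where x2: "x2 \<in> ?A V2" "HG m V2 E2 = Hx m V2 E2 x2" using HG_attained[OF m V(2)] .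
    define x where "x = (\<lambda>i. if i \<in> V1 then x1 i else x2 i)"
    have "Hx m V1 E1 x1 = Hx m V1 E1 x"
      by (rule Hx_cong[OF E(1)]) (simp add: x_def)
    moreover have "Hx m V2 E2 x2 = Hx m V2 E2 x"
      by (rule Hx_cong[OF E(2)]) (use V in \<open>auto simp: x_def\<close>)
    moreover have "x \<in> ?A (V1 \<union> V2)"
      using x1(1) x2(1) by (auto simp: x_def PiE_iff extensional_def)
    then have "Hx m (V1 \<union> V2) (E1 @ E2) x \<le> HG m (V1 \<union> V2) (E1 @ E2)"
      using V by (intro Hx_le_HG[OF m]) auto
    ultimately show "HG m V1 E1 + HG m V2 E2 \<le> HG m (V1 \<union> V2) (E1 @ E2)"
      by (simp add: x1(2) x2(2) add)
  qed
qed

section \<open>Invariance under relabelling of nodes\<close>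

abbreviation relabel :: "(nat \<Rightarrow> nat) \<Rightarrow> edge \<Rightarrow> edge" where
  "relabel f \<equiv> \<lambda>(xs, a). (map f xs, a)"

lemma HG_relabel:
  assumes f: "inj_on f V" and E: "wf_graph m V E"
  shows "HG m (f ` V) (map (relabel f) E) = HG m V E"
proof -
  let ?A = "\<lambda>V. PiE V (\<lambda>_. {..<nstates m})"
  have Hx: "Hx m (f ` V) (map (relabel f) E) x = Hx m V E (x \<circ> f)" for x
    using f by (simp add: Hx_def sum.reindex comp_def case_prod_beta)
  have "Hx m (f ` V) (map (relabel f) E) ` ?A (f ` V) = Hx m V E ` ?A V"
  proof (intro equalityI subsetI)
    fix h assume "h \<in> Hx m (f ` V) (map (relabel f) E) ` ?A (f ` V)"
    then obtain x where x: "x \<in> ?A (f ` V)" "h = Hx m V E (x \<circ> f)" by (auto simp: Hx)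
    moreover have "Hx m V E (x \<circ> f) = Hx m V E (restrict (x \<circ> f) V)"
      by (rule Hx_cong[OF E]) simp
    moreover have "restrict (x \<circ> f) V \<in> ?A V" using x(1) by (auto simp: PiE_iff)
    ultimately show "h \<in> Hx m V E ` ?A V" by auto
  next
    fix h assume "h \<in> Hx m V E ` ?A V"
    then obtain y where y: "y \<in> ?A V" "h = Hx m V E y" by auto
    \<comment> \<open>Transports \<open>y\<close> along the inverse of \<open>f\<close>; the
      restriction makes the result extensional, as \<open>PiE\<close> demands.\<close>
    define x where "x = restrict (y \<circ> inv_into V f) (f ` V)"
    have "Hx m V E y = Hx m V E (x \<circ> f)"
      by (rule Hx_cong[OF E]) (simp add: x_def f)
    moreover have "x \<in> ?A (f ` V)" using y(1) f by (auto simp: x_def PiE_iff)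
    ultimately show "h \<in> Hx m (f ` V) (map (relabel f) E) ` ?A (f ` V)"
      using y(2) by (auto simp: Hx)
  qed
  then show ?thesis by (simp add: HG_def)
qed

lemma edge_pmf_relabel:
  assumes f: "inj_on f V" and V: "finite V" "V \<noteq> {}"
  shows "edge_pmf m (f ` V) = map_pmf (relabel f) (edge_pmf m V)"
proof -
  define L where "L = (\<lambda>U. {xs :: nat list. set xs \<subseteq> U \<and> length xs = arity m})"
  have "L (f ` V) = map f ` L V"
  proof (intro equalityI subsetI)
    fix xs assume "xs \<in> L (f ` V)"
    then have xs: "set xs \<subseteq> f ` V" "length xs = arity m" by (auto simp: L_def)
    have "map f (map (inv_into V f) xs) = xs"
      unfolding map_map by (rule map_idI) (use xs in \<open>auto simp: f_inv_into_f\<close>)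
    moreover have "map (inv_into V f) xs \<in> L V"
      using xs by (auto simp: L_def intro: inv_into_into)
    ultimately show "xs \<in> map f ` L V" by (metis imageI)
  qed (auto simp: L_def subset_iff)
  moreover have "inj_on (map f) (L V)"
    by (rule inj_on_mapI, rule inj_on_subset[OF f]) (auto simp: L_def)
  moreover have "finite (L V)"
    unfolding L_def using V(1) by (rule finite_lists_length_eq)
  moreover obtain v where "v \<in> V" using V by auto
  then have "replicate (arity m) v \<in> L V" by (auto simp: L_def)
  then have "L V \<noteq> {}" by auto
  ultimately have "pmf_of_set (L (f ` V)) = map_pmf (map f) (pmf_of_set (L V))"
    by (simp add: map_pmf_of_set_inj)
  then show ?thesis
    using map_pair[of "map f" "\<lambda>a. a" "pmf_of_set (L V)" "sign_pmf m"] by (simp add: edge_pmf_def L_def)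
qed

lemma rgraph_relabel:
  assumes "inj_on f V" "finite V" "V \<noteq> {}"
  shows "rgraph m (f ` V) n = map_pmf (map (relabel f)) (rgraph m V n)"
  by (induction n)
     (simp_all add: edge_pmf_relabel[OF assms] map_pmf_def bind_assoc_pmf bind_return_pmf)

section \<open>Supports of the random graphs\<close>

lemma set_pmf_edge_pmf:
  assumes V: "finite V" "V \<noteq> {}"
  shows "finite (set_pmf (edge_pmf m V))"
    and "e \<in> set_pmf (edge_pmf m V) \<Longrightarrow> set (fst e) \<subseteq> V \<and> length (fst e) = arity m"
proof -
  let ?L = "{xs :: nat list. set xs \<subseteq> V \<and> length xs = arity m}"
  have fin: "finite ?L" using V by (intro finite_lists_length_eq)
  obtain v where "v \<in> V" using V by auto
  then have "replicate (arity m) v \<in> ?L" by auto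
  then have ne: "?L \<noteq> {}" by blast
  have signs: "finite {a :: bool list. length a = K}" "{a :: bool list. length a = K} \<noteq> {}" for K
    using finite_lists_length_eq[of "UNIV :: bool set" K] Ex_list_of_length by auto
  have "finite (set_pmf (sign_pmf m))"
    using signs by (cases m) (auto simp: sign_pmf_def)
  then show "finite (set_pmf (edge_pmf m V))"
    using fin ne by (simp add: edge_pmf_def)
  show "e \<in> set_pmf (edge_pmf m V) \<Longrightarrow> set (fst e) \<subseteq> V \<and> length (fst e) = arity m"
    using fin ne by (auto simp: edge_pmf_def)
qed

lemma set_pmf_rgraph:
  assumes V: "finite V" "V \<noteq> {}"
  shows "finite (set_pmf (rgraph m V n))"
    and "E \<in> set_pmf (rgraph m V n) \<Longrightarrow> wf_graph m V E \<and> length E = n"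
proof -
  have "set_pmf (rgraph m V n) = {E. set E \<subseteq> set_pmf (edge_pmf m V) \<and> length E = n}"
    by (auto simp: rgraph_eq_replicate_pmf set_replicate_pmf)
  then show "finite (set_pmf (rgraph m V n))"
    "E \<in> set_pmf (rgraph m V n) \<Longrightarrow> wf_graph m V E \<and> length E = n"
    using set_pmf_edge_pmf[OF V, where m = m] unfolding wf_graph_def
    by (simp_all add: finite_lists_length_eq) blast
qed

text \<open>In these models nodes contribute 0 and edges at most 1. Hence satisfying all edges is
  the same as the tail event at the number of edges.\<close>

lemma HG_le_length:
  assumes csp: "is_csp m" and "valid_model m" "finite V"
  shows "HG m V E \<le> ereal (real (length E))"
proof -
  have "hedge m a ys \<le> 1" for a ys
    using csp by (cases m) (auto simp: is_csp_def)
  then have "(\<Sum>e\<leftarrow>E. hedge m (snd e) (map x (fst e))) \<le> ereal (real (length E))" for x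
  proof (induction E)
    case (Cons e E)
    then have "hedge m (snd e) (map x (fst e)) + (\<Sum>e\<leftarrow>E. hedge m (snd e) (map x (fst e))) \<le>
        1 + ereal (real (length E))"
      by (intro add_mono) auto
    then show ?case by (simp add: one_ereal_def add.commute)
  qed simp
  moreover have "hnode m v = 0" for v
    using csp by (cases m) (auto simp: is_csp_def)
  ultimately have "Hx m V E x \<le> ereal (real (length E))" for x
    by (simp add: Hx_def)
  then show ?thesis
    using HG_attained[OF assms(2,3)] by metis
qed

section \<open>Comparison of expectations and conclusion\<close>

lemma set_pmf_split_graphs:
  assumes V: "finite V1" "finite V2" "V1 \<noteq> {}" "V2 \<noteq> {}" and p: "p \<in> {0..1}"
  shows "finite (set_pmf (split_graphs m V1 V2 p n))"
    and "(E1, E2) \<in> set_pmf (split_graphs m V1 V2 p n) \<Longrightarrow> wf_graph m V1 E1 \<and> wf_graph m V2 E2"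
proof -
  show "finite (set_pmf (split_graphs m V1 V2 p n))"
    using finite_set_pmf_binomial_pmf[OF p, of n] set_pmf_rgraph(1)[OF V(1,3)] set_pmf_rgraph(1)[OF V(2,4)]
    by (simp add: split_graphs_def)
  show "wf_graph m V1 E1 \<and> wf_graph m V2 E2" if "(E1, E2) \<in> set_pmf (split_graphs m V1 V2 p n)"
    using that set_pmf_rgraph(2)[OF V(1,3)] set_pmf_rgraph(2)[OF V(2,4)] by (auto simp: split_graphs_def)
qed

text \<open>The two terms on the left are expectations over the marginals of
  \<open>split_graphs\<close>. By linearity and additivity over disjoint unions they combine into
  one expectation, to which the tail comparison applies.\<close>

lemma expectation_split_graphs_le:
  assumes m: "valid_model m" and V: "finite V1" "finite V2" "V1 \<noteq> {}" "V2 \<noteq> {}" "V1 \<inter> V2 = {}"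
  defines "p \<equiv> real (card V1) / real (card (V1 \<union> V2))"
  shows "EH m V1 (binomial_pmf n p) + EH m V2 (map_pmf (\<lambda>k. n - k) (binomial_pmf n p)) \<le>
    EH m (V1 \<union> V2) (return_pmf n)"
proof -
  let ?V = "V1 \<union> V2" and ?G = "split_graphs m V1 V2 p n"
  let ?h = "\<lambda>V E. real_of_ereal (HG m V E)"
  have p: "p \<in> {0..1}"
    unfolding p_def using V card_mono[of "V1 \<union> V2" V1] by (auto simp: divide_le_eq_1)
  note G = set_pmf_split_graphs[OF V(1-4) p, where m = m and n = n]
  have R: "finite ?V" "?V \<noteq> {}" using V by auto
  have "EH m V1 (binomial_pmf n p) = measure_pmf.expectation (map_pmf fst ?G) (?h V1)"
    by (simp add: EH_def split_graphs_def map_bind_pmf map_fst_pair_pmf del: integral_map_pmf)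
  moreover have "EH m V2 (map_pmf (\<lambda>k. n - k) (binomial_pmf n p)) = measure_pmf.expectation (map_pmf snd ?G) (?h V2)"
    by (simp add: EH_def split_graphs_def map_bind_pmf map_snd_pair_pmf bind_map_pmf del: integral_map_pmf)
  ultimately have "EH m V1 (binomial_pmf n p) + EH m V2 (map_pmf (\<lambda>k. n - k) (binomial_pmf n p)) =
      measure_pmf.expectation ?G (\<lambda>(E1, E2). ?h V1 E1 + ?h V2 E2)"
    using G(1) by (simp add: integrable_measure_pmf_finite case_prod_beta')
  also have "\<dots> = measure_pmf.expectation ?G (\<lambda>(E1, E2). ?h ?V (E1 @ E2))"
  \<comment> \<open>On the support both graphs are well formed, so both maxima are finite and
    \<open>real_of_ereal\<close> is additive on them.\<close>
  proof (intro integral_cong_AE AE_pmfI)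
    fix G assume "G \<in> set_pmf ?G"
    moreover obtain E1 E2 where "G = (E1, E2)" by fastforce
    ultimately show "(case G of (E1, E2) \<Rightarrow> ?h V1 E1 + ?h V2 E2) = (case G of (E1, E2) \<Rightarrow> ?h ?V (E1 @ E2))"
      using G(2)[of E1 E2] HG_disjoint_union[OF m V(1,2,5), of E1 E2] HG_finite[OF m V(1), of E1] HG_finite[OF m V(2), of E2]
      by (simp add: real_of_ereal_add)
  qed auto
  also have "\<dots> \<le> measure_pmf.expectation (rgraph m ?V n) (?h ?V)"
  proof (rule expectation_mono_of_tails)
    fix t
    have wf: "wf_graph m ?V (E1 @ E2)" if "(E1, E2) \<in> set_pmf ?G" for E1 E2
      using G(2)[OF that] by (auto simp: wf_graph_def)
    \<comment> \<open>Finiteness is essential here, because \<open>real_of_ereal\<close> sends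
      infinite values to 0.\<close>
    have le_iff: "t \<le> ?h ?V E \<longleftrightarrow> ereal t \<le> HG m ?V E" if "wf_graph m ?V E" for E
      using HG_finite[OF m R(1) that] by (cases "HG m ?V E") auto
    have "measure_pmf.prob ?G {x. t \<le> (case x of (E1, E2) \<Rightarrow> ?h ?V (E1 @ E2))} =
        measure_pmf.prob ?G {(E1, E2). ereal t \<le> HG m ?V (E1 @ E2)}"
      by (rule measure_pmf.finite_measure_eq_AE) (auto intro!: AE_pmfI simp: le_iff wf)
    also have "\<dots> \<le> measure_pmf.prob (rgraph m ?V n) {E. ereal t \<le> HG m ?V E}"
      unfolding p_def by (rule prob_split_graphs_tail_le[OF m V])
    also have "\<dots> = measure_pmf.prob (rgraph m ?V n) {E. t \<le> ?h ?V E}"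
      by (rule measure_pmf.finite_measure_eq_AE)
         (auto intro!: AE_pmfI simp: le_iff dest!: set_pmf_rgraph(2)[OF R])
    finally show "measure_pmf.prob ?G {x. t \<le> (case x of (E1, E2) \<Rightarrow> ?h ?V (E1 @ E2))} \<le>
        measure_pmf.prob (rgraph m ?V n) {E. t \<le> ?h ?V E}" .
  qed (use G(1) set_pmf_rgraph(1)[OF R] in auto)
  finally show ?thesis
    by (simp add: EH_def bind_return_pmf)
qed

lemma EH_relabel:
  assumes f: "inj_on f V" and V: "finite V" "V \<noteq> {}"
  shows "EH m (f ` V) D = EH m V D"
proof -
  have "bind_pmf D (rgraph m (f ` V)) = map_pmf (map (relabel f)) (bind_pmf D (rgraph m V))"
    by (simp add: rgraph_relabel[OF f V, abs_def] map_bind_pmf)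
  then have "EH m (f ` V) D = measure_pmf.expectation (bind_pmf D (rgraph m V))
      (\<lambda>E. real_of_ereal (HG m (f ` V) (map (relabel f) E)))"
    by (simp add: EH_def)
  also have "\<dots> = EH m V D"
    unfolding EH_def
    by (intro integral_cong_AE AE_pmfI) (auto dest!: set_pmf_rgraph(2)[OF V] simp: HG_relabel[OF f])
  finally show ?thesis .
qed

theorem theorem5:
  fixes m :: model and c :: real and N N1 N2 :: nat
  assumes "valid_model m" and "c > 0"
    and "1 \<le> N1" and "N1 \<le> N - 1" and "1 \<le> N2" and "N2 \<le> N - 1" and "N1 + N2 = N"
  shows "EH m {..<N} (return_pmf (nat \<lfloor>c * real N\<rfloor>))
           \<ge> EH m {..<N1} (binomial_pmf (nat \<lfloor>c * real N\<rfloor>) (real N1 / real N))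
             + EH m {..<N2} (map_pmf (\<lambda>M1. nat \<lfloor>c * real N\<rfloor> - M1)
                                (binomial_pmf (nat \<lfloor>c * real N\<rfloor>) (real N1 / real N)))
       \<and> (is_csp m \<longrightarrow>
           psat m N (nat \<lfloor>c * real N\<rfloor>)
           \<ge> measure_pmf.prob
               (bind_pmf (binomial_pmf (nat \<lfloor>c * real N\<rfloor>) (real N1 / real N)) (\<lambda>M1.
                  bind_pmf (rgraph m {..<N1} M1) (\<lambda>E1.
                  bind_pmf (rgraph m {N1..<N} (nat \<lfloor>c * real N\<rfloor> - M1)) (\<lambda>E2.
                  return_pmf (M1 + (nat \<lfloor>c * real N\<rfloor> - M1), E1 @ E2)))))
               {(M, E). HG m {..<N} E = ereal (real M)})"
proof -
  define n where "n = nat \<lfloor>c * real N\<rfloor>"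
  define p where "p = real N1 / real N"
  note m = assms(1)
  let ?V1 = "{..<N1}" and ?V2 = "{N1..<N}"
  have V: "finite ?V1" "finite ?V2" "?V1 \<noteq> {}" "?V2 \<noteq> {}" "?V1 \<inter> ?V2 = {}" and U: "?V1 \<union> ?V2 = {..<N}"
    using assms by (auto simp: lessThan_empty_iff)
  \<comment> \<open>The expectation is stated on \<open>{..<N2}\<close>, but the disjoint union
    needs the second graph on \<open>{N1..<N}\<close>; a shift by \<open>N1\<close> relates the
    two.\<close>
  have V2: "?V2 = (\<lambda>i. i + N1) ` {..<N2}"
    using assms(7) by (simp add: image_add_atLeastLessThan' lessThan_atLeast0 add.commute)
  have p: "p = real (card ?V1) / real (card (?V1 \<union> ?V2))" "p \<in> {0..1}"
    unfolding U using assms by (auto simp: p_def)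
  have "EH m {..<N2} D = EH m ?V2 D" for D
    unfolding V2 by (rule EH_relabel[symmetric]) (use assms in \<open>auto simp: inj_on_def lessThan_empty_iff\<close>)
  then have expectation: "EH m ?V1 (binomial_pmf n p) + EH m {..<N2} (map_pmf (\<lambda>k. n - k) (binomial_pmf n p)) \<le>
      EH m {..<N} (return_pmf n)"
    using expectation_split_graphs_le[OF m V, of n, folded p(1), unfolded U] by simp
  have satisfiability: "measure_pmf.prob (bind_pmf (binomial_pmf n p) (\<lambda>M1. bind_pmf (rgraph m ?V1 M1) (\<lambda>E1.
      bind_pmf (rgraph m ?V2 (n - M1)) (\<lambda>E2. return_pmf (M1 + (n - M1), E1 @ E2)))))
      {(M, E). HG m {..<N} E = ereal (real M)} \<le> psat m N n" (is "measure_pmf.prob ?P _ \<le> _") if csp: "is_csp m"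
  proof -
    \<comment> \<open>On the support of the binomial \<open>M1 \<le> n\<close>, so
      \<open>M1 + (n - M1)\<close> is \<open>n\<close> despite truncated subtraction.\<close>
    have "?P = bind_pmf (binomial_pmf n p) (\<lambda>M1. bind_pmf (rgraph m ?V1 M1) (\<lambda>E1.
        bind_pmf (rgraph m ?V2 (n - M1)) (\<lambda>E2. return_pmf (n, E1 @ E2))))"
      using p(2) by (intro bind_pmf_cong refl) (auto simp: set_pmf_binomial_eq split: if_splits)
    also have "\<dots> = map_pmf (\<lambda>(E1, E2). (n, E1 @ E2)) (split_graphs m ?V1 ?V2 p n)"
      by (simp add: split_graphs_def map_pmf_def pair_pmf_def bind_assoc_pmf bind_return_pmf)
    finally have P: "?P = map_pmf (\<lambda>(E1, E2). (n, E1 @ E2)) (split_graphs m ?V1 ?V2 p n)" .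
    \<comment> \<open>Equality with \<open>n\<close> is weakened to the tail event for the split
      graph and recovered for the large graph from \<open>HG_le_length\<close>.\<close>
    have "measure_pmf.prob ?P {(M, E). HG m {..<N} E = ereal (real M)} \<le>
        measure_pmf.prob (split_graphs m ?V1 ?V2 p n) {(E1, E2). ereal (real n) \<le> HG m {..<N} (E1 @ E2)}"
      unfolding P measure_map_pmf by (intro measure_pmf.finite_measure_mono) auto
    also have "\<dots> \<le> measure_pmf.prob (rgraph m {..<N} n) {E. ereal (real n) \<le> HG m {..<N} E}"
      by (rule prob_split_graphs_tail_le[OF m V, of n "real n", folded p(1), unfolded U])
    also have "\<dots> = psat m N n"
      unfolding psat_def
    proof (intro measure_pmf.finite_measure_eq_AE AE_pmfI)
      fix E assume "E \<in> set_pmf (rgraph m {..<N} n)"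
      then have "length E = n" using set_pmf_rgraph(2)[of "{..<N}"] V(3) U by blast
      then show "E \<in> {E. ereal (real n) \<le> HG m {..<N} E} \<longleftrightarrow> E \<in> {E. HG m {..<N} E = ereal (real n)}"
        using HG_le_length[OF csp m, of "{..<N}" E] by auto
    qed auto
    finally show ?thesis .
  qed
  from expectation satisfiability show ?thesis
    unfolding n_def p_def by blast
qed

end
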